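(* Let $\mathbb{X}$ be an absolutely ordered space and $x_0,x,y\in\mathbb{X}$. If $x\sim_{x_0}y$, then (1) $\alpha x\sim_{x_0}\alpha y$ for all $\alpha\in\mathbb{R}$; and (2) $x\sim_{\beta x_0}y$ for all $\beta\in\mathbb{R}$. In particular, if $x\sim_{x_0}y$, then $\alpha x\sim_{\beta x_0}\alpha y$ for all $\alpha,\beta\in\mathbb{R}$.
   Context: A cone in a real vector space $\mathbb{X}$ is a non-empty subset $\mathbb{X}^+$ closed under addition and under multiplication by non-negative reals; then $(\mathbb{X},\mathbb{X}^+)$ is a real ordered vector space, with $x\le y$ iff $y-x\in\mathbb{X}^+$. An absolutely ordered space is a real ordered vector space $(\mathbb{X},\mathbb{X}^+)$ with a map $|\cdot|:\mathbb{X}\to\mathbb{X}^+$ such that: (a) $|x|=x$ if $x\in\mathbb{X}^+$; (b) $|x|\pm x\in\mathbb{X}^+$ for all $x\in\mathbb{X}$; (c) $|\alpha x|=|\alpha||x|$ for all $x\in\mathbb{X}$, $\alpha\in\mathbb{R}$; (d) if $x,y,z\in\mathbb{X}$ with $|x-y|=x+y$ and $0\le z\le y$, then $|x-z|=x+z$; (e) if $x,y,z\in\mathbb{X}$ with $|x-y|=x+y$ and $|x-z|=x+z$, then $\big|x-|y\pm z|\big|=x+|y\pm z|$ (for each choice of sign). For $x,y\in\mathbb{X}^+$, $x\perp y$ means $|x-y|=x+y$; for arbitrary $x,y\in\mathbb{X}$, $x\perp y$ means $|x|\perp|y|$. For $x_0,x,y\in\mathbb{X}$, $x\sim_{x_0}y$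 (strong relation) means $(x-y)\perp x_0$. *)

theory Defs
  imports Complex_Main
begin

text \<open>
  The ambient real vector space is the type \<open>'a\<close>; the cone \<open>P\<close> is not required to be proper,
  so the induced relation is only a preorder.
\<close>

locale ordered_real_vector_space =
  fixes P :: "'a::real_vector set"
  assumes cone_nonempty: "P \<noteq> {}"
    and cone_add: "\<And>x y. x \<in> P \<Longrightarrow> y \<in> P \<Longrightarrow> x + y \<in> P"
    and cone_scaleR: "\<And>a x. 0 \<le> a \<Longrightarrow> x \<in> P \<Longrightarrow> a *\<^sub>R x \<in> P"

definition cone_le :: "'a::real_vector set \<Rightarrow> 'a \<Rightarrow> 'a \<Rightarrow> bool"
  where "cone_le P x y \<longleftrightarrow> y - x \<in> P"

locale absolutely_ordered_space = ordered_real_vector_space P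
  for P :: "'a::real_vector set" +
  fixes av :: "'a \<Rightarrow> 'a"
  assumes av_in_cone: "\<And>x. av x \<in> P"
    and av_of_cone: "\<And>x. x \<in> P \<Longrightarrow> av x = x"
    and av_plus: "\<And>x. av x + x \<in> P"
    and av_minus: "\<And>x. av x - x \<in> P"
    and av_scaleR: "\<And>a x. av (a *\<^sub>R x) = \<bar>a\<bar> *\<^sub>R av x"
    and av_below: "\<And>x y z. av (x - y) = x + y \<Longrightarrow> cone_le P 0 z \<Longrightarrow> cone_le P z y
      \<Longrightarrow> av (x - z) = x + z"
    and av_sum: "\<And>x y z. av (x - y) = x + y \<Longrightarrow> av (x - z) = x + z
      \<Longrightarrow> av (x - av (y + z)) = x + av (y + z)"
    and av_diff: "\<And>x y z. av (x - y) = x + y \<Longrightarrow> av (x - z) = x + z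
      \<Longrightarrow> av (x - av (y - z)) = x + av (y - z)"

definition cone_orth :: "('a::real_vector \<Rightarrow> 'a) \<Rightarrow> 'a \<Rightarrow> 'a \<Rightarrow> bool"
  where "cone_orth av x y \<longleftrightarrow> av (x - y) = x + y"

text \<open>
  \<open>cone_orth\<close> is meant for elements of the cone. On the cone \<open>abs_orth\<close> coincides with it,
  because there \<open>av\<close> is the identity.
\<close>

definition abs_orth :: "('a::real_vector \<Rightarrow> 'a) \<Rightarrow> 'a \<Rightarrow> 'a \<Rightarrow> bool"
  where "abs_orth av x y \<longleftrightarrow> cone_orth av (av x) (av y)"

lemma (in absolutely_ordered_space) abs_orth_on_cone:
  "x \<in> P \<Longrightarrow> y \<in> P \<Longrightarrow> abs_orth av x y \<longleftrightarrow> cone_orth av x y"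
  by (simp add: abs_orth_def av_of_cone)

definition strong_rel :: "('a::real_vector \<Rightarrow> 'a) \<Rightarrow> 'a \<Rightarrow> 'a \<Rightarrow> 'a \<Rightarrow> bool"
  where "strong_rel av x0 x y \<longleftrightarrow> abs_orth av (x - y) x0"

end

theory Submission
  imports Defs
begin

text \<open>
  Because \<open>|\<alpha> z| = |\<alpha>| |z|\<close>, everything reduces to one property of elements \<open>u\<close>, \<open>v\<close> of the
  cone: if \<open>u \<perp> v\<close>, then \<open>a u \<perp> b v\<close> for all \<open>a, b \<ge> 0\<close>. Homogeneity of the absolute value
  gives this at once when \<open>a = b\<close>. For different factors, scale both elements by \<open>max a b\<close> and
  then shrink each of them separately: by axiom (d) orthogonality survives replacing the second
  element by a smaller one in the cone, and by \<open>|-z| = |z|\<close> the relation is symmetric, so the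
  same holds for the first (\<open>cone_orth_scaleR\<close>). All three parts of the theorem are instances of
  the resulting statement for arbitrary elements (\<open>abs_orth_scaleR\<close>).
\<close>

context absolutely_ordered_space
begin

lemma cone_orth_sym:
  assumes "cone_orth av u v"
  shows "cone_orth av v u"
proof -
  have "av (v - u) = av (u - v)"
    using av_scaleR[of "-1" "u - v"] by simp
  then show ?thesis
    using assms by (simp add: cone_orth_def add.commute)
qed

lemma cone_orth_scaleR_same:
  assumes "cone_orth av u v" and "0 \<le> c"
  shows "cone_orth av (c *\<^sub>R u) (c *\<^sub>R v)"
  using assms av_scaleR[of c "u - v"]
  by (simp add: cone_orth_def scaleR_diff_right scaleR_add_right)

text \<open>
  Axiom (d) applies since \<open>0 \<le> b v \<le> c v\<close> when \<open>v\<close> is in the cone and \<open>0 \<le> b \<le> c\<close>.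
\<close>

lemma cone_orth_shrink_right:
  assumes "cone_orth av u (c *\<^sub>R v)" and "v \<in> P" and "0 \<le> b" and "b \<le> c"
  shows "cone_orth av u (b *\<^sub>R v)"
proof -
  have "cone_le P 0 (b *\<^sub>R v)"
    using assms(2,3) by (simp add: cone_le_def cone_scaleR)
  moreover have "cone_le P (b *\<^sub>R v) (c *\<^sub>R v)"
    using cone_scaleR[of "c - b" v] assms(2,4)
    by (simp add: cone_le_def scaleR_diff_left)
  ultimately show ?thesis
    using assms(1) av_below unfolding cone_orth_def by blast
qed

lemma cone_orth_scaleR:
  assumes "cone_orth av u v" and "u \<in> P" and "v \<in> P" and "0 \<le> a" and "0 \<le> b"
  shows "cone_orth av (a *\<^sub>R u) (b *\<^sub>R v)"
proof -
  define c where "c = max a b"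
  have "cone_orth av (c *\<^sub>R u) (c *\<^sub>R v)"
    using assms by (intro cone_orth_scaleR_same) (auto simp: c_def)
  then have "cone_orth av (c *\<^sub>R u) (b *\<^sub>R v)"
    by (rule cone_orth_shrink_right) (use assms in \<open>auto simp: c_def\<close>)
  then have "cone_orth av (b *\<^sub>R v) (c *\<^sub>R u)"
    by (rule cone_orth_sym)
  then have "cone_orth av (b *\<^sub>R v) (a *\<^sub>R u)"
    by (rule cone_orth_shrink_right) (use assms in \<open>auto simp: c_def\<close>)
  then show ?thesis
    by (rule cone_orth_sym)
qed

lemma abs_orth_scaleR:
  assumes "abs_orth av z w"
  shows "abs_orth av (a *\<^sub>R z) (b *\<^sub>R w)"
  using assms cone_orth_scaleR[of "av z" "av w" "\<bar>a\<bar>" "\<bar>b\<bar>"]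
  by (simp add: abs_orth_def av_scaleR av_in_cone)

lemma strong_rel_scaleR:
  assumes "strong_rel av x0 x y"
  shows "strong_rel av (b *\<^sub>R x0) (a *\<^sub>R x) (a *\<^sub>R y)"
  using assms abs_orth_scaleR[of "x - y" x0 a b]
  by (simp add: strong_rel_def scaleR_diff_right)

end

theorem proposition3p4:
  fixes P :: "'a::real_vector set" and av :: "'a \<Rightarrow> 'a" and x0 x y :: 'a
  assumes "absolutely_ordered_space P av"
    and "strong_rel av x0 x y"
  shows "(\<forall>\<alpha>::real. strong_rel av x0 (\<alpha> *\<^sub>R x) (\<alpha> *\<^sub>R y))
    \<and> (\<forall>\<beta>::real. strong_rel av (\<beta> *\<^sub>R x0) x y)
    \<and> (\<forall>\<alpha> \<beta>::real. strong_rel av (\<beta> *\<^sub>R x0) (\<alpha> *\<^sub>R x) (\<alpha> *\<^sub>R y))"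
proof -
  interpret absolutely_ordered_space P av
    by (fact assms(1))
  have scaled: "strong_rel av (\<beta> *\<^sub>R x0) (\<alpha> *\<^sub>R x) (\<alpha> *\<^sub>R y)" for \<alpha> \<beta> :: real
    using assms(2) by (rule strong_rel_scaleR)
  show ?thesis
    using scaled scaled[of 1] scaled[where \<alpha> = 1] by simp
qed

end
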